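(* For integers $0 \leq k \leq n$ with $n \equiv k \pmod{2}$, $$\sum_{T \in \mathcal{R}(n,k)} q^{\mathsf{comaj}(T)} = q^{\binom{k}{2}} \begin{bmatrix} n \\ k \end{bmatrix}_q C_{\frac{n-k}{2}}(q),$$ where $C_m(q) = \frac{1}{[m+1]_q} \begin{bmatrix} 2m \\ m \end{bmatrix}_q$ denotes the $m$th $q$-Catalan number.
   Context: A standard Young tableau (SYT) of shape a partition $\lambda$ of $n$ is a filling of the Young diagram of $\lambda$ (English notation, rows numbered top to bottom) with $1,\dots,n$, each used once, strictly increasing along rows and down columns. For an SYT $T$ of size $n$, let $r_j(T)$ be the row number containing the entry $j$, and let $T_{<j}$ be the subtableau of entries $1,\dots,j-1$. $T$ is a Richardson tableau if for each $1\le j\le n$ with $r_j(T)\ge 2$, the largest entry of $T_{<j}$ in row $r_j(T)-1$ is greater than every entry of $T_{<j}$ in rows $i\ge r_j(T)$. $\mathcal{R}(n,k)$ is the set of Richardson tableaux of size $n$ (of any shape) with exactly $k$ odd columns, i.e. columns containing an odd number of boxes. For an SYT $T$ of size $n$, $i\in\{1,\dots,n-1\}$ is a descent of $T$ if $i+1$ appears in a row strictly below that of $i$; otherwise $i$ is an ascent. $\mathsf{comaj}(T)$ is the sum of all ascents of $T$. $q$-notation: $[n]_q=\frac{1-q^n}{1-q}$, $[n]_q!=[1]_q\cdots[n]_q$, $[0]_q!=1$, and $\begin{bmatrix} n\\k\end{bmatrix}_q=\frac{[n]_q!}{[k]_q![n-k]_q!}$ if $n\ge k\ge 0$, and $0$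 otherwise. *)

theory Defs
  imports "HOL-Computational_Algebra.Computational_Algebra"
begin

section \<open>Standard Young tableaux\<close>

definition is_partition :: "nat \<Rightarrow> nat list \<Rightarrow> bool" where
  "is_partition n p \<longleftrightarrow> sorted_wrt (\<ge>) p \<and> (\<forall>x \<in> set p. 0 < x) \<and> sum_list p = n"

text \<open>A filling of a Young diagram (English notation) is the list of its rows, from top to bottom,
  each row being read from left to right.\<close>

type_synonym tableau = "nat list list"

definition shape :: "tableau \<Rightarrow> nat list" where
  "shape T = map length T"

definition SYT :: "nat \<Rightarrow> nat list \<Rightarrow> tableau set" where
  "SYT n p = {T. shape T = p \<and>
     distinct (concat T) \<and> set (concat T) = {1..n} \<and>
     (\<forall>R \<in> set T. sorted_wrt (<) R) \<and>
     (\<forall>i c. Suc i < length T \<and> c < length (T ! Suc i) \<longrightarrow> T ! i ! c < T ! Suc i ! c)}"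

definition tab_size :: "tableau \<Rightarrow> nat" where
  "tab_size T = length (concat T)"

text \<open>Rows are numbered from 1, whereas list positions start at 0.\<close>

definition row_entries :: "tableau \<Rightarrow> nat \<Rightarrow> nat set" where
  "row_entries T i = (if 1 \<le> i \<and> i \<le> length T then set (T ! (i - 1)) else {})"

definition row_of :: "tableau \<Rightarrow> nat \<Rightarrow> nat" where
  "row_of T j = (THE i. j \<in> row_entries T i)"

definition subtab_below :: "tableau \<Rightarrow> nat \<Rightarrow> tableau" where
  "subtab_below T j = filter (\<lambda>R. R \<noteq> []) (map (filter (\<lambda>x. x < j)) T)"


section \<open>Richardson tableaux\<close>

text \<open>For a standard Young tableau the set under \<^const>\<open>Max\<close> is nonempty: it contains the entry
  of the box immediately above that of \<open>j\<close>.\<close>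

definition richardson :: "tableau \<Rightarrow> bool" where
  "richardson T \<longleftrightarrow>
     (\<forall>j \<in> {1..tab_size T}. 2 \<le> row_of T j \<longrightarrow>
        (\<forall>i \<ge> row_of T j. \<forall>x \<in> row_entries (subtab_below T j) i.
           x < Max (row_entries (subtab_below T j) (row_of T j - 1))))"

definition column_length :: "tableau \<Rightarrow> nat \<Rightarrow> nat" where
  "column_length T c = card {i. i < length T \<and> c < length (T ! i)}"

text \<open>Column indices beyond the first row give length 0, hence are not counted.\<close>

definition num_odd_columns :: "tableau \<Rightarrow> nat" where
  "num_odd_columns T = card {c. odd (column_length T c)}"

definition richardson_tableaux :: "nat \<Rightarrow> nat \<Rightarrow> tableau set" where
  "richardson_tableaux n k =
     {T. (\<exists>p. is_partition n p \<and> T \<in> SYT n p) \<and> richardson T \<and> num_odd_columns T = k}"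


section \<open>Descents and comaj\<close>

definition is_descent :: "tableau \<Rightarrow> nat \<Rightarrow> bool" where
  "is_descent T i \<longleftrightarrow> row_of T i < row_of T (i + 1)"

definition ascents :: "tableau \<Rightarrow> nat set" where
  "ascents T = {i \<in> {1..<tab_size T}. \<not> is_descent T i}"

definition comaj :: "tableau \<Rightarrow> nat" where
  "comaj T = \<Sum> (ascents T)"


section \<open>The \<open>q\<close>-notation\<close>

text \<open>\<open>q_var\<close> is the formal variable; quotients are taken in the field of fractions of the
  polynomial ring over the integers.\<close>

definition q_var :: "int poly fract" where
  "q_var = Fract [:0, 1:] 1"

definition q_int :: "nat \<Rightarrow> int poly fract" where
  "q_int n = (1 - q_var ^ n) / (1 - q_var)"

definition q_fact :: "nat \<Rightarrow> int poly fract" where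
  "q_fact n = (\<Prod>i = 1..n. q_int i)"

definition q_binomial :: "nat \<Rightarrow> nat \<Rightarrow> int poly fract" where
  "q_binomial n k = (if k \<le> n then q_fact n / (q_fact k * q_fact (n - k)) else 0)"

definition q_catalan :: "nat \<Rightarrow> int poly fract" where
  "q_catalan m = 1 / q_int (m + 1) * q_binomial (2 * m) m"

end

theory Submission
  imports Defs
begin

text \<open>Encode a tableau by its row word \<open>w\<^sub>j = r\<^sub>j - 1\<close>. The tableau is Richardson iff for every
  letter \<open>b + 1\<close> the last preceding letter \<open>\<ge> b\<close> equals \<open>b\<close>; this already implies the lattice
  condition. Hence an ascent at \<open>i\<close> means \<open>w\<^bsub>i+1\<^esub> = 0\<close>, and \<open>comaj\<close> is the sum of \<open>j - 1\<close> over the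
  positions \<open>j\<close> of the letter \<open>0\<close>.

  Deleting the first row (the letters \<open>0\<close>) leaves a Richardson word, shifted by one, and conversely a
  word \<open>u\<close> is extended by putting a \<open>0\<close> directly before each of its first-row letters and
  distributing the remaining zeros freely. With \<open>m\<close> zeros in total and \<open>x\<close> letters in the first row
  of \<open>u\<close>, the free zeros contribute a Gaussian binomial. So the generating functions \<open>B(n,m,k)\<close>,
  where \<open>m\<close> is the length of the first row, satisfy
  \<open>B(n,m,k) = q\<^bsup>m(m-1)/2\<^esup> \<Sum>\<^sub>x [n-x, m-x] B(n-m, x, m-k)\<close>.
  For \<open>n = 2p + k\<close> they have the product form
  \<open>B(n,m,k) = q\<^bsup>k(k-1)/2 + (m-k)(m-1)\<^esup> [p+k-1, m-1] [p+1, m-k] [p+k]! / ([k]! [p+1]!)\<close>: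
  the recursion is an instance of the \<open>q\<close>-Pfaff--Saalschuetz identity, and summing over \<open>m\<close> is
  an instance of the \<open>q\<close>-Vandermonde identity.\<close>

section \<open>Gaussian binomial coefficients\<close>

lemma q_var_power: "q_var ^ n = Fract ([:0, 1:] ^ n) 1"
  by (induction n) (simp_all add: q_var_def One_fract_def)

text \<open>Comparing degrees shows that the formal variable is not a root of unity; hence
  q-integers of positive arguments, and all denominators built from them, are nonzero.\<close>

lemma q_var_power_eq_1_iff: "q_var ^ n = 1 \<longleftrightarrow> n = 0"
proof
  assume "q_var ^ n = 1"
  then have "[:0, 1 :: int:] ^ n = 1"
    by (simp add: q_var_power One_fract_def eq_fract)
  then have "degree ([:0, 1 :: int:] ^ n) = 0"
    by simp
  then show "n = 0"
    by (simp add: degree_power_eq)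
qed simp

lemma q_int_nonzero [simp]: "0 < n \<Longrightarrow> q_int n \<noteq> 0"
  using q_var_power_eq_1_iff[of n] q_var_power_eq_1_iff[of 1] by (simp add: q_int_def)

lemma q_int_add: "q_int (a + b) = q_int a + q_var ^ a * q_int b"
  using q_var_power_eq_1_iff[of 1]
  by (simp add: q_int_def field_simps power_add)

lemma q_fact_0 [simp]: "q_fact 0 = 1"
  by (simp add: q_fact_def)

lemma q_fact_Suc: "q_fact (Suc n) = q_int (Suc n) * q_fact n"
  by (simp add: q_fact_def mult.commute)

lemma q_fact_nonzero [simp]: "q_fact n \<noteq> 0"
  by (induction n) (simp_all add: q_fact_Suc)

lemma q_binomial_0_right [simp]: "q_binomial n 0 = 1"
  by (simp add: q_binomial_def)

lemma q_binomial_self [simp]: "q_binomial n n = 1"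
  by (simp add: q_binomial_def)

lemma q_binomial_eq_0: "n < k \<Longrightarrow> q_binomial n k = 0"
  by (simp add: q_binomial_def)

lemma q_binomial_symmetric: "k \<le> n \<Longrightarrow> q_binomial n (n - k) = q_binomial n k"
  by (simp add: q_binomial_def mult.commute)

text \<open>The q-Pascal rule, from the splitting [n+1] = [n-k] + q^(n-k) [k+1] over a common
  denominator.\<close>

lemma q_binomial_Suc_Suc:
  "q_binomial (Suc n) (Suc k) = q_var ^ (n - k) * q_binomial n k + q_binomial n (Suc k)"
proof (cases "k < n")
  case True
  then obtain d where d: "n = Suc (k + d)"
    using less_iff_Suc_add by auto
  have "q_int (Suc n) = q_int (Suc d) + q_var ^ Suc d * q_int (Suc k)"
    using q_int_add[of "Suc d" "Suc k"] by (simp add: d add.commute)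
  moreover have "q_binomial (Suc n) (Suc k)
      = q_int (Suc n) * q_fact n / ((q_int (Suc k) * q_fact k) * (q_int (Suc d) * q_fact d))"
    and "q_binomial n k = q_fact n / (q_fact k * (q_int (Suc d) * q_fact d))"
    and "q_binomial n (Suc k) = q_fact n / ((q_int (Suc k) * q_fact k) * q_fact d)"
    and "n - k = Suc d"
    by (simp_all add: q_binomial_def d q_fact_Suc)
  ultimately show ?thesis
    by (simp only:) (simp add: divide_simps, simp add: algebra_simps)
next
  case False
  then show ?thesis
    by (cases "k = n") (simp_all add: q_binomial_eq_0)
qed

text \<open>Induction on \<open>b\<close>, with the q-Pascal rule applied to the second factor. If
  \<open>a - (r - j)\<close> is truncated, then \<open>q_binomial a (r - j)\<close> is zero.\<close>

lemma q_vandermonde: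
  "(\<Sum>j\<le>r. q_var ^ (j * (a - (r - j))) * q_binomial a (r - j) * q_binomial b j)
     = q_binomial (a + b) r"
proof (induction b arbitrary: r)
  case 0
  have "(\<Sum>j\<le>r. q_var ^ (j * (a - (r - j))) * q_binomial a (r - j) * q_binomial 0 j)
      = (\<Sum>j\<in>{0}. q_var ^ (j * (a - (r - j))) * q_binomial a (r - j) * q_binomial 0 j)"
    by (rule sum.mono_neutral_right) (auto simp: q_binomial_eq_0)
  then show ?case
    by simp
next
  case (Suc b)
  show ?case
  proof (cases r)
    case 0
    then show ?thesis
      by simp
  next
    case (Suc s)
    define F where "F j = q_var ^ (j * (a - (r - j))) * q_binomial a (r - j)" for j
    have shift: "F (Suc i) * (q_var ^ (b - i) * q_binomial b i)
        = q_var ^ (a + b - s) *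
            (q_var ^ (i * (a - (s - i))) * q_binomial a (s - i) * q_binomial b i)"
      if "i \<le> s" for i
    \<comment> \<open>The exponents are compared where no subtraction is truncated; otherwise one of
      the two binomials vanishes.\<close>
    proof (cases "s - i \<le> a \<and> i \<le> b")
      case True
      then have "a + b - s = (b - i) + (a - (s - i))"
        using that by linarith
      then have e: "Suc i * (a - (s - i)) + (b - i) = (a + b - s) + i * (a - (s - i))"
        by simp
      have "F (Suc i) * (q_var ^ (b - i) * q_binomial b i)
          = q_var ^ (Suc i * (a - (s - i)) + (b - i)) * (q_binomial a (s - i) * q_binomial b i)"
        by (simp add: F_def Suc power_add mult_ac)
      also have "\<dots> = q_var ^ (a + b - s) *
            (q_var ^ (i * (a - (s - i))) * q_binomial a (s - i) * q_binomial b i)"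
        by (simp only: e power_add mult_ac)
      finally show ?thesis .
    next
      case False
      then have "q_binomial a (s - i) * q_binomial b i = 0"
        by (auto simp: q_binomial_eq_0)
      then show ?thesis
        by (auto simp: F_def Suc)
    qed
    have "(\<Sum>j\<le>r. F j * q_binomial (Suc b) j)
        = F 0 + (\<Sum>i\<le>s. F (Suc i) * (q_var ^ (b - i) * q_binomial b i + q_binomial b (Suc i)))"
      by (simp add: Suc sum.atMost_Suc_shift q_binomial_Suc_Suc del: sum.atMost_Suc)
    also have "\<dots> = (\<Sum>i\<le>s. F (Suc i) * (q_var ^ (b - i) * q_binomial b i))
        + (\<Sum>j\<le>r. F j * q_binomial b j)"
      by (simp add: Suc sum.atMost_Suc_shift sum.distrib ring_distribs del: sum.atMost_Suc)
    also have "(\<Sum>i\<le>s. F (Suc i) * (q_var ^ (b - i) * q_binomial b i))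
        = q_var ^ (a + b - s) * q_binomial (a + b) s"
      by (simp add: shift flip: Suc.IH sum_distrib_left)
    also have "(\<Sum>j\<le>r. F j * q_binomial b j) = q_binomial (a + b) r"
      by (simp only: F_def Suc.IH)
    finally have "(\<Sum>j\<le>r. F j * q_binomial (Suc b) j) = q_binomial (a + Suc b) r"
      by (simp add: Suc q_binomial_Suc_Suc)
    then show ?thesis
      by (simp only: F_def)
  qed
qed

text \<open>Same identity with the power of q distributed differently: the two factors trade places
  and the summation is reversed.\<close>

lemma q_vandermonde':
  "(\<Sum>j\<le>r. q_var ^ ((r - j) * (b - j)) * q_binomial a (r - j) * q_binomial b j)
     = q_binomial (a + b) r"
proof -
  have "(\<Sum>j\<le>r. q_var ^ ((r - j) * (b - j)) * q_binomial a (r - j) * q_binomial b j)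
      = (\<Sum>j\<le>r. q_var ^ (j * (b - (r - j))) * q_binomial b (r - j) * q_binomial a j)"
    by (rule sum.reindex_bij_witness[of _ "\<lambda>j. r - j" "\<lambda>j. r - j"]) (auto simp: mult_ac)
  then show ?thesis
    by (simp only: q_vandermonde add.commute)
qed

text \<open>Both sides are the q-trinomial coefficient of \<open>a\<close> with parts
  \<open>j\<close>, \<open>k - j\<close>, \<open>a - k\<close>; both vanish for
  \<open>k > a\<close>.\<close>

lemma q_binomial_mult:
  "q_binomial a k * q_binomial k j = q_binomial a j * q_binomial (a - j) (k - j)"
    if "j \<le> k"
proof (cases "k \<le> a")
  case True
  then show ?thesis
    using that by (simp add: q_binomial_def)
next
  case False
  then show ?thesis
    using that by (cases "a < j") (simp_all add: q_binomial_eq_0)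
qed

text \<open>Expand the last factor by the Vandermonde identity, then sum first over \<open>k\<close> and next over the
  new index: both are again Vandermonde sums.\<close>

lemma q_pfaff_saalschutz:
  assumes "a + b = M + N"
  shows "(\<Sum>k\<le>N. q_var ^ ((N - k) * (a - k)) * q_binomial a k * q_binomial b (N - k)
            * q_binomial (M + t + k) (M + N))
         = q_binomial (M + t) M * q_binomial (t + a) N"
proof -
  define E where "E k = q_var ^ ((N - k) * (a - k)) * q_binomial b (N - k)" for k
  define G where "G j = q_var ^ (j * (t - (N - j))) * q_binomial (M + t) (M + N - j)" for j
  have ex: "q_binomial (M + t + k) (M + N) = (\<Sum>j\<le>N. G j * q_binomial k j)"
    if "k \<le> N" for k
  proof -
    have "q_binomial (M + t + k) (M + N) = (\<Sum>j\<le>M + N. q_var ^ (j * (M + t - (M + N - j)))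
              * q_binomial (M + t) (M + N - j) * q_binomial k j)"
      by (rule q_vandermonde[symmetric])
    also have "\<dots> = (\<Sum>j\<le>N. q_var ^ (j * (M + t - (M + N - j)))
              * q_binomial (M + t) (M + N - j) * q_binomial k j)"
      by (rule sum.mono_neutral_right) (use that in \<open>auto simp: q_binomial_eq_0\<close>)
    also have "\<dots> = (\<Sum>j\<le>N. G j * q_binomial k j)"
      by (intro sum.cong refl) (simp add: G_def)
    finally show ?thesis .
  qed
  have inner: "(\<Sum>k\<le>N. E k * (q_binomial a k * q_binomial k j))
      = q_binomial a j * q_binomial (M + N - j) (N - j)" if "j \<le> N" for j
  proof (cases "j \<le> a")
    case True
    have "(\<Sum>k\<le>N. E k * (q_binomial a k * q_binomial k j))
        = (\<Sum>k\<in>{j..N}. E k * (q_binomial a k * q_binomial k j))"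
      by (rule sum.mono_neutral_right) (auto simp: q_binomial_eq_0)
    also have "\<dots> = (\<Sum>i\<le>N - j. E (i + j) * (q_binomial a (i + j) * q_binomial (i + j) j))"
      by (rule sum.reindex_bij_witness[of _ "\<lambda>i. i + j" "\<lambda>k. k - j"]) (use that in auto)
    also have "\<dots> = (\<Sum>i\<le>N - j. q_binomial a j * (q_var ^ ((N - j - i) * (a - j - i))
              * q_binomial b (N - j - i) * q_binomial (a - j) i))"
      by (intro sum.cong refl) (simp add: q_binomial_mult E_def mult_ac add.commute)
    also have "\<dots> = q_binomial a j * q_binomial (b + (a - j)) (N - j)"
      by (simp only: q_vandermonde' flip: sum_distrib_left)
    finally show ?thesis
      using True assms by (simp add: add.commute)
  next
    case False
    then have "q_binomial a k = 0 \<or> q_binomial k j = 0" for k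
      by (cases "k < j") (auto simp: q_binomial_eq_0)
    then have "(\<Sum>k\<le>N. E k * (q_binomial a k * q_binomial k j)) = 0"
      by (intro sum.neutral) simp
    then show ?thesis
      using False by (simp add: q_binomial_eq_0)
  qed
  have "(\<Sum>k\<le>N. q_var ^ ((N - k) * (a - k)) * q_binomial a k * q_binomial b (N - k)
            * q_binomial (M + t + k) (M + N))
      = (\<Sum>k\<le>N. \<Sum>j\<le>N. G j * (E k * (q_binomial a k * q_binomial k j)))"
    by (simp add: ex E_def sum_distrib_left mult_ac)
  also have "\<dots> = (\<Sum>j\<le>N. G j * (q_binomial a j * q_binomial (M + N - j) (N - j)))"
    by (subst sum.swap) (simp add: inner flip: sum_distrib_left)
  also have "\<dots> = (\<Sum>j\<le>N. q_binomial (M + t) M *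
      (q_var ^ (j * (t - (N - j))) * q_binomial t (N - j) * q_binomial a j))"
  \<comment> \<open>Symmetry and \<open>q_binomial_mult\<close> extract
    \<open>q_binomial (M + t) M\<close>, which does not depend on \<open>j\<close>; a Vandermonde
    sum in \<open>j\<close> remains.\<close>
  proof (intro sum.cong refl)
    fix j assume "j \<in> {..N}"
    then have "q_binomial (M + N - j) (N - j) = q_binomial (M + N - j) M"
      using q_binomial_symmetric[of M "M + N - j"] by simp
    moreover have "q_binomial (M + t) (M + N - j) * q_binomial (M + N - j) M
        = q_binomial (M + t) M * q_binomial t (N - j)"
      using q_binomial_mult[of M "M + N - j" "M + t"] \<open>j \<in> {..N}\<close> by simp
    ultimately show "G j * (q_binomial a j * q_binomial (M + N - j) (N - j))
      = q_binomial (M + t) M *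
        (q_var ^ (j * (t - (N - j))) * q_binomial t (N - j) * q_binomial a j)"
      by (simp add: G_def mult_ac)
  qed
  also have "\<dots> = q_binomial (M + t) M * q_binomial (t + a) N"
    by (simp only: q_vandermonde flip: sum_distrib_left)
  finally show ?thesis .
qed

section \<open>Richardson words\<close>

text \<open>A tableau is encoded by its row word in reverse: the \<open>i\<close>-th letter from the right is
  \<open>r\<^sub>i - 1\<close>. Thus the head of the list is the row index of the largest entry.\<close>

fun exposed :: "nat \<Rightarrow> nat list \<Rightarrow> bool" where
  "exposed b [] \<longleftrightarrow> False"
| "exposed b (a # u) \<longleftrightarrow> a = b \<or> a < b \<and> exposed b u"

text \<open>As the head belongs to the largest entry, the tail encodes the subtableau of smaller
  entries, so the Richardson condition at each entry relates a head to its tail.\<close>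

fun rich :: "nat list \<Rightarrow> bool" where
  "rich [] \<longleftrightarrow> True"
| "rich (0 # u) \<longleftrightarrow> rich u"
| "rich (Suc b # u) \<longleftrightarrow> rich u \<and> exposed b u"

text \<open>The entry at the head is \<open>Suc (length u)\<close>, so a first-row entry j
  contributes j - 1. On Richardson words this turns out to be \<open>comaj\<close>.\<close>

fun zero_weight :: "nat list \<Rightarrow> nat" where
  "zero_weight [] = 0"
| "zero_weight (a # u) = (if a = 0 then length u else 0) + zero_weight u"

text \<open>The inner set consists of the rows longer than \<open>c\<close>, so its cardinality is
  the height of column \<open>c\<close>, counted from 0.\<close>

definition odd_cols :: "nat list \<Rightarrow> nat" where
  "odd_cols w = card {c. odd (card {i. c < count_list w i})}"

lemma exposed_imp_in_set: "exposed b u \<Longrightarrow> b \<in> set u"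
  by (induction u) auto

text \<open>The lattice condition. Strictness while \<open>b\<close> is exposed is the room for one
  more \<open>Suc b\<close>, and adding that letter ends the exposure, so both claims go through one
  induction.\<close>

lemma rich_ballot:
  "rich u \<Longrightarrow> count_list u (Suc b) \<le> count_list u b \<and>
    (exposed b u \<longrightarrow> count_list u (Suc b) < count_list u b)"
  by (induction u rule: rich.induct) (auto simp: less_Suc_eq)

lemma rich_count_le_zeros: "rich u \<Longrightarrow> count_list u b \<le> count_list u 0"
proof (induction b)
  case (Suc b)
  then show ?case
    using rich_ballot[of u b] by simp
qed simp

lemma rich_count_zero_pos:
  assumes "rich u" "u \<noteq> []"
  shows "0 < count_list u 0"
proof -
  have "0 < count_list u (hd u)"
    using assms by (cases u) auto
  then show ?thesis
    using rich_count_le_zeros[OF assms(1), of "hd u"] by simp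
qed

section \<open>Removing the first row\<close>

fun strip :: "nat list \<Rightarrow> nat list" where
  "strip [] = []"
| "strip (0 # u) = strip u"
| "strip (Suc a # u) = a # strip u"

text \<open>The part of the Richardson condition that \<open>strip\<close> forgets: below a letter 1
  the condition \<open>exposed 0\<close> forces a zero, whereas the conditions at larger letters
  ignore zeros and survive in the stripped word.\<close>

fun glued :: "nat list \<Rightarrow> bool" where
  "glued [] \<longleftrightarrow> True"
| "glued (0 # u) \<longleftrightarrow> glued u"
| "glued (Suc 0 # u) \<longleftrightarrow> u \<noteq> [] \<and> hd u = 0 \<and> glued u"
| "glued (Suc (Suc a) # u) \<longleftrightarrow> glued u"

lemma exposed_Suc: "exposed (Suc b) u \<longleftrightarrow> exposed b (strip u)"
  by (induction u rule: strip.induct) auto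

lemma exposed_0: "exposed 0 u \<longleftrightarrow> u \<noteq> [] \<and> hd u = 0"
  by (cases u) auto

lemma rich_iff_strip: "rich w \<longleftrightarrow> rich (strip w) \<and> glued w"
  by (induction w rule: glued.induct) (auto simp: exposed_Suc exposed_0)

lemma count_strip: "count_list (strip w) b = count_list w (Suc b)"
  by (induction w rule: strip.induct) auto

lemma length_strip: "length (strip w) + count_list w 0 = length w"
  by (induction w rule: strip.induct) auto

text \<open>Each 1 owns the zero glued to it. The extra summand records a leading zero that is still
  unclaimed, which the next 1 may take.\<close>

lemma glued_count:
  "glued w \<Longrightarrow> count_list w (Suc 0) + (if w \<noteq> [] \<and> hd w = 0 then 1 else 0) \<le> count_list w 0"
  by (induction w rule: glued.induct) auto

text \<open>Deleting the first row shortens each column by one and flips its parity, so each of the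
  \<open>count_list w 0\<close> columns is odd in exactly one of \<open>w\<close> and
  \<open>strip w\<close>.\<close>

lemma odd_cols_strip:
  assumes "rich w"
  shows "odd_cols w + odd_cols (strip w) = count_list w 0"
proof -
  define H where "H v c = {i. c < count_list v i}" for v :: "nat list" and c
  define Od where "Od v = {c. odd (card (H v c))}" for v
  have fin: "finite (H v c)" for v c
  proof (rule finite_subset)
    show "H v c \<subseteq> set v"
    proof
      fix i assume "i \<in> H v c"
      then have "count_list v i \<noteq> 0"
        by (simp add: H_def)
      then show "i \<in> set v"
        by (simp add: count_list_0_iff)
    qed
  qed simp
  have H: "H w c = insert 0 (Suc ` H (strip w) c)" if "c < count_list w 0" for c
  proof (rule set_eqI)
    show "i \<in> H w c \<longleftrightarrow> i \<in> insert 0 (Suc ` H (strip w) c)" for i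
      using that by (cases i) (auto simp: H_def count_strip)
  qed
  have empty: "H w c = {}" "H (strip w) c = {}" if "\<not> c < count_list w 0" for c
    using rich_count_le_zeros[OF assms] that by (auto simp: H_def count_strip dest: less_le_trans)
  have "card (H w c) = Suc (card (H (strip w) c))" if "c < count_list w 0" for c
    using fin by (simp add: H[OF that] card_image)
  then have "c \<in> Od w \<longleftrightarrow> c < count_list w 0 \<and> c \<notin> Od (strip w)" for c
    using empty[of c] by (cases "c < count_list w 0") (auto simp: Od_def)
  then have "Od w = {..<count_list w 0} - Od (strip w)"
    by auto
  moreover have sub: "Od (strip w) \<subseteq> {..<count_list w 0}"
    using empty(2) by (fastforce simp: Od_def)
  moreover have "finite (Od (strip w))"
    using sub by (rule finite_subset) simp
  moreover have "card (Od (strip w)) \<le> count_list w 0"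
    using card_mono[OF _ sub] by simp
  ultimately show ?thesis
    by (simp add: odd_cols_def H_def[symmetric] Od_def[symmetric] card_Diff_subset)
qed

lemma odd_cols_le_zeros: "rich w \<Longrightarrow> odd_cols w \<le> count_list w 0"
  using odd_cols_strip[of w] by simp

text \<open>One zero is forced by each first-row letter of \<open>u\<close>, which becomes a 1 in
  \<open>w\<close>; \<open>f\<close> counts the remaining, free zeros.\<close>

definition strip_fibre :: "nat list \<Rightarrow> nat \<Rightarrow> nat list set" where
  "strip_fibre u f = {w. glued w \<and> strip w = u \<and> count_list w 0 = f + count_list u 0}"

section \<open>Recursion for the fibres of \<open>strip\<close>\<close>

lemma strip_fibre_Nil_0: "strip_fibre [] 0 = {[]}"
proof -
  have "w = []" if "w \<in> strip_fibre [] 0" for w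
    using that length_strip[of w] by (simp add: strip_fibre_def)
  then show ?thesis
    by (auto simp: strip_fibre_def)
qed

lemma strip_fibre_Nil_Suc: "strip_fibre [] (Suc f) = (#) 0 ` strip_fibre [] f"
proof (rule set_eqI)
  show "w \<in> strip_fibre [] (Suc f) \<longleftrightarrow> w \<in> (#) 0 ` strip_fibre [] f" for w
    by (cases w rule: strip.cases) (auto simp: strip_fibre_def)
qed

lemma strip_fibre_Cons_0_0: "strip_fibre (0 # u) 0 = (\<lambda>w. Suc 0 # 0 # w) ` strip_fibre u 0"
proof (rule set_eqI)
  fix w
  show "w \<in> strip_fibre (0 # u) 0 \<longleftrightarrow> w \<in> (\<lambda>w. Suc 0 # 0 # w) ` strip_fibre u 0"
  proof (cases w rule: glued.cases)
    \<comment> \<open>A leading zero would be free: \<open>v\<close> alone already has at least as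
      many zeros as ones.\<close>
    case (2 v)
    then show ?thesis
      using glued_count[of v] count_strip[of v 0] by (auto simp: strip_fibre_def)
  next
    case (3 v)
    then show ?thesis
      by (cases v) (auto simp: strip_fibre_def)
  qed (auto simp: strip_fibre_def)
qed

text \<open>A word of the fibre starts either with a free zero or with the raised head of
  \<open>0 # u\<close>, a 1 that brings along its glued zero.\<close>

lemma strip_fibre_Cons_0_Suc:
  "strip_fibre (0 # u) (Suc f)
     = (#) 0 ` strip_fibre (0 # u) f \<union> (\<lambda>w. Suc 0 # 0 # w) ` strip_fibre u (Suc f)"
proof (rule set_eqI)
  fix w
  show "w \<in> strip_fibre (0 # u) (Suc f) \<longleftrightarrow>
    w \<in> (#) 0 ` strip_fibre (0 # u) f \<union> (\<lambda>w. Suc 0 # 0 # w) ` strip_fibre u (Suc f)"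
  proof (cases w rule: glued.cases)
    case (3 v)
    then show ?thesis
      by (cases v) (auto simp: strip_fibre_def)
  qed (auto simp: strip_fibre_def)
qed

lemma strip_fibre_Cons_Suc_0:
  "strip_fibre (Suc b # u) 0 = (#) (Suc (Suc b)) ` strip_fibre u 0"
proof (rule set_eqI)
  fix w
  show "w \<in> strip_fibre (Suc b # u) 0 \<longleftrightarrow> w \<in> (#) (Suc (Suc b)) ` strip_fibre u 0"
  proof (cases w rule: glued.cases)
    case (2 v)
    then show ?thesis
      using glued_count[of v] count_strip[of v 0] by (auto simp: strip_fibre_def)
  qed (auto simp: strip_fibre_def)
qed

lemma strip_fibre_Cons_Suc_Suc:
  "strip_fibre (Suc b # u) (Suc f)
     = (#) 0 ` strip_fibre (Suc b # u) f \<union> (#) (Suc (Suc b)) ` strip_fibre u (Suc f)"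
proof (rule set_eqI)
  show "w \<in> strip_fibre (Suc b # u) (Suc f) \<longleftrightarrow> w \<in> (#) 0 ` strip_fibre (Suc b # u) f
      \<union> (#) (Suc (Suc b)) ` strip_fibre u (Suc f)" for w
    by (cases w rule: glued.cases) (auto simp: strip_fibre_def)
qed

lemma length_strip_fibre:
  "w \<in> strip_fibre u f \<Longrightarrow> length w = length u + f + count_list u 0"
  using length_strip[of w] by (auto simp: strip_fibre_def)

lemma sum_fibre_Cons:
  "(\<Sum>w\<in>(#) a ` strip_fibre u f. q_var ^ zero_weight w)
     = q_var ^ (if a = 0 then length u + f + count_list u 0 else 0)
         * (\<Sum>w\<in>strip_fibre u f. q_var ^ zero_weight w)"
  by (subst sum.reindex)
    (auto simp: inj_on_def power_add sum_distrib_left length_strip_fibre intro!: sum.cong)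

lemma sum_fibre_Cons_1_0:
  "(\<Sum>w\<in>(\<lambda>w. Suc 0 # 0 # w) ` strip_fibre u f. q_var ^ zero_weight w)
     = q_var ^ (length u + f + count_list u 0) * (\<Sum>w\<in>strip_fibre u f. q_var ^ zero_weight w)"
  by (subst sum.reindex)
    (auto simp: inj_on_def power_add sum_distrib_left length_strip_fibre intro!: sum.cong)

text \<open>The two cases of each recursion for \<^const>\<open>strip_fibre\<close> match the \<open>q\<close>-Pascal rule.\<close>

lemma sum_strip_fibre:
  "finite (strip_fibre u f) \<and>
    (\<Sum>w\<in>strip_fibre u f. q_var ^ zero_weight w)
      = q_var ^ ((f + count_list u 0) choose 2) * q_var ^ zero_weight u
          * q_binomial (length u + f) f"
proof (induction u arbitrary: f)
  case Nil
  show ?case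
  proof (induction f)
    case (Suc f)
    then show ?case
      by (simp add: strip_fibre_Nil_Suc sum_fibre_Cons eval_nat_numeral power_add)
  qed (simp add: strip_fibre_Nil_0 eval_nat_numeral)
next
  case (Cons a u)
  note IHu = Cons.IH
  show ?case
  \<comment> \<open>Removing a leading free zero lowers \<open>f\<close> but keeps
    \<open>a # u\<close>, hence a second induction inside the one on the word.\<close>
  proof (induction f)
    case 0
    show ?case
      using IHu[of 0]
      by (cases a)
        (simp_all only: strip_fibre_Cons_0_0 strip_fibre_Cons_Suc_0 sum_fibre_Cons
          sum_fibre_Cons_1_0, simp_all add: eval_nat_numeral power_add mult_ac)
  next
    case (Suc f)
    show ?case
    proof (cases a)
      case 0
      have disj: "(#) 0 ` strip_fibre (0 # u) f \<inter> (\<lambda>w. Suc 0 # 0 # w) ` strip_fibre u (Suc f) = {}"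
        by auto
      show ?thesis
        unfolding 0 strip_fibre_Cons_0_Suc
        using Suc.IH[unfolded 0] IHu[of "Suc f"]
        by (simp add: sum.union_disjoint[OF _ _ disj] sum_fibre_Cons
            sum_fibre_Cons_1_0 q_binomial_Suc_Suc eval_nat_numeral power_add
            algebra_simps)
    next
      case b: (Suc b)
      have disj: "(#) 0 ` strip_fibre (Suc b # u) f
          \<inter> (#) (Suc (Suc b)) ` strip_fibre u (Suc f) = {}"
        by auto
      show ?thesis
        unfolding b strip_fibre_Cons_Suc_Suc
        using Suc.IH[unfolded b] IHu[of "Suc f"]
        by (simp add: sum.union_disjoint[OF _ _ disj] sum_fibre_Cons
            q_binomial_Suc_Suc eval_nat_numeral power_add algebra_simps)
    qed
  qed
qed

section \<open>Counting words by their first row\<close>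

definition rich_words :: "nat \<Rightarrow> nat \<Rightarrow> nat \<Rightarrow> nat list set" where
  "rich_words n m k = {w. rich w \<and> length w = n \<and> count_list w 0 = m \<and> odd_cols w = k}"

definition rich_gf :: "nat \<Rightarrow> nat \<Rightarrow> nat \<Rightarrow> int poly fract" where
  "rich_gf n m k = (\<Sum>w\<in>rich_words n m k. q_var ^ zero_weight w)"

lemma rich_imp_set_less: "rich w \<Longrightarrow> set w \<subseteq> {..<length w}"
proof (induction w rule: rich.induct)
  case (3 b u)
  then show ?case
    using exposed_imp_in_set[of b u] by auto
qed auto

lemma finite_rich_words: "finite (rich_words n m k)"
proof (rule finite_subset)
  show "rich_words n m k \<subseteq> {w. set w \<subseteq> {..<n} \<and> length w = n}"
    using rich_imp_set_less by (auto simp: rich_words_def)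
qed (rule finite_lists_length_eq, simp)

lemma rich_words_empty:
  assumes "m < k \<or> n < m \<or> m = 0 \<and> 0 < n"
  shows "rich_words n m k = {}"
proof -
  have False if "w \<in> rich_words n m k" for w
    using that assms odd_cols_le_zeros[of w] length_strip[of w] rich_count_zero_pos[of w]
    by (cases "w = []") (auto simp: rich_words_def)
  then show ?thesis
    by blast
qed

text \<open>Here \<open>x\<close> is the length of the second row, which is the first row of the
  stripped word; \<open>m - k\<close> comes from the parity flip in
  \<open>odd_cols_strip\<close>.\<close>

lemma rich_words_decomp:
  assumes "k \<le> m" "m \<le> n"
  shows "rich_words n m k =
    (\<Union>x\<in>{..m}. \<Union>u\<in>rich_words (n - m) x (m - k). strip_fibre u (m - x))"
proof (intro equalityI subsetI)
  fix w assume w: "w \<in> rich_words n m k"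
  define u where "u = strip w"
  have "rich u" "glued w"
    using w by (simp_all add: rich_words_def rich_iff_strip[of w] u_def)
  moreover have "count_list u 0 \<le> m"
    using w rich_count_le_zeros[of w 1] by (simp add: u_def count_strip rich_words_def)
  moreover have "length u = n - m" "odd_cols u = m - k"
    using w length_strip[of w] odd_cols_strip[of w] by (auto simp: u_def rich_words_def)
  ultimately show "w \<in> (\<Union>x\<in>{..m}. \<Union>u\<in>rich_words (n - m) x (m - k). strip_fibre u (m - x))"
    using w by (intro UN_I[of "count_list u 0"] UN_I[of u])
      (auto simp: rich_words_def strip_fibre_def u_def)
next
  fix w assume "w \<in> (\<Union>x\<in>{..m}. \<Union>u\<in>rich_words (n - m) x (m - k). strip_fibre u (m - x))"
  then show "w \<in> rich_words n m k"
    using assms rich_iff_strip[of w] length_strip[of w] odd_cols_strip[of w]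
    by (auto simp: rich_words_def strip_fibre_def)
qed

text \<open>Sums \<open>sum_strip_fibre\<close> with \<open>f = m - x\<close>: since
  \<open>f + x = m\<close>, the power of q coming from the new first row does not depend on
  \<open>x\<close>.\<close>

lemma rich_gf_rec:
  assumes "k \<le> m" "m \<le> n"
  shows "rich_gf n m k =
    q_var ^ (m choose 2) * (\<Sum>x\<le>m. q_binomial (n - x) (m - x) * rich_gf (n - m) x (m - k))"
proof -
  define U where "U x = (\<Union>u\<in>rich_words (n - m) x (m - k). strip_fibre u (m - x))" for x
  have "rich_gf n m k = (\<Sum>x\<le>m. \<Sum>w\<in>U x. q_var ^ zero_weight w)"
    unfolding rich_gf_def rich_words_decomp[OF assms] U_def[symmetric]
  proof (rule sum.UNION_disjoint)
    show "\<forall>x\<in>{..m}. finite (U x)"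
      by (simp add: U_def finite_rich_words sum_strip_fibre)
    show "\<forall>x\<in>{..m}. \<forall>y\<in>{..m}. x \<noteq> y \<longrightarrow> U x \<inter> U y = {}"
      by (auto simp: U_def strip_fibre_def rich_words_def)
  qed simp
  also have "\<dots> = (\<Sum>x\<le>m. \<Sum>u\<in>rich_words (n - m) x (m - k).
      \<Sum>w\<in>strip_fibre u (m - x). q_var ^ zero_weight w)"
  proof (rule sum.cong[OF refl])
    show "(\<Sum>w\<in>U x. q_var ^ zero_weight w) = (\<Sum>u\<in>rich_words (n - m) x (m - k).
        \<Sum>w\<in>strip_fibre u (m - x). q_var ^ zero_weight w)" for x
      unfolding U_def
      by (rule sum.UNION_disjoint[OF finite_rich_words])
        (auto simp: sum_strip_fibre, auto simp: strip_fibre_def)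
  qed
  also have "\<dots> = (\<Sum>x\<le>m. q_var ^ (m choose 2) * (q_binomial (n - x) (m - x)
      * rich_gf (n - m) x (m - k)))"
  proof (rule sum.cong[OF refl])
    fix x assume x: "x \<in> {..m}"
    have "(\<Sum>u\<in>rich_words (n - m) x (m - k). \<Sum>w\<in>strip_fibre u (m - x). q_var ^ zero_weight w)
      = (\<Sum>u\<in>rich_words (n - m) x (m - k).
          q_var ^ (m choose 2) * q_binomial (n - x) (m - x) * q_var ^ zero_weight u)"
      using x assms by (intro sum.cong refl) (auto simp: sum_strip_fibre rich_words_def)
    then show "(\<Sum>u\<in>rich_words (n - m) x (m - k).
          \<Sum>w\<in>strip_fibre u (m - x). q_var ^ zero_weight w)
      = q_var ^ (m choose 2) * (q_binomial (n - x) (m - x) * rich_gf (n - m) x (m - k))"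
      by (simp add: rich_gf_def sum_distrib_left mult.assoc)
  qed
  finally show ?thesis
    by (simp add: sum_distrib_left)
qed

lemma rich_gf_0: "rich_gf 0 0 0 = 1"
proof -
  have "rich_words 0 0 0 = {[]}"
    by (auto simp: rich_words_def odd_cols_def)
  then show ?thesis
    by (simp add: rich_gf_def)
qed

section \<open>The product formula and its sum over first-row lengths\<close>

lemma choose_2_add: "(a + b) choose 2 = (a choose 2) + (b choose 2) + a * b"
  by (induction a) (simp_all add: eval_nat_numeral)

lemma double_choose_2: "(n choose 2) + (n choose 2) = n * (n - 1)"
proof (induction n)
  case (Suc n)
  then show ?case
    by (cases n) (simp_all add: eval_nat_numeral)
qed (simp add: eval_nat_numeral)

lemma q_fact_1 [simp]: "q_fact (Suc 0) = 1"
  using q_var_power_eq_1_iff[of 1] by (simp add: q_fact_def q_int_def)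

text \<open>Strong induction on the size, with \<open>l\<close> the number of odd columns after the
  first row is removed. The hypotheses keep the differences \<open>p + k - 1\<close> and
  \<open>k + l - 1\<close> from being truncated.\<close>

lemma rich_gf_closed:
  assumes "1 \<le> k + l" "1 \<le> 2 * p + k"
  shows "rich_gf (2 * p + k) (k + l) k =
    q_var ^ (k choose 2) * q_var ^ (l * (k + l - 1)) * q_binomial (p + k - 1) (k + l - 1)
      * q_binomial (p + 1) l * (q_fact (p + k) / (q_fact k * q_fact (p + 1)))"
  using assms
proof (induction "2 * p + k" arbitrary: p k l rule: less_induct)
  case less
  show ?case
  proof (cases "l \<le> p")
    case False
    \<comment> \<open>For \<open>l = p + 1\<close> the first factor vanishes, for larger
      \<open>l\<close> the second.\<close>
    then have "q_binomial (p + k - 1) (k + l - 1) * q_binomial (p + 1) l = 0"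
      using less.prems by (cases "l = p + 1") (auto simp: q_binomial_eq_0)
    moreover have "rich_gf (2 * p + k) (k + l) k = 0"
    proof (cases "k + l \<le> 2 * p + k")
      case True
      \<comment> \<open>Only \<open>2 * p - l < l\<close> letters are left, too few for
        \<open>l\<close> odd columns.\<close>
      have "rich_words (2 * p + k - (k + l)) x (k + l - k) = {}" for x
        using False by (intro rich_words_empty) auto
      then have "rich_gf (2 * p + k - (k + l)) x (k + l - k) = 0" for x
        by (simp add: rich_gf_def)
      then show ?thesis
        using True by (subst rich_gf_rec) simp_all
    qed (simp add: rich_gf_def rich_words_empty)
    ultimately show ?thesis
      by auto
  next
    case True
    define n where "n = 2 * p + k"
    define m where "m = k + l"
    have mn: "k \<le> m" "m \<le> n"
      using True by (simp_all add: n_def m_def)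
    show ?thesis
    proof (cases "p = 0")
      case p0: True
      \<comment> \<open>Stripping now leaves the empty word, which the induction hypothesis does not
        cover.\<close>
      then have "l = 0"
        using True by simp
      have "rich_gf 0 x 0 = (if x = 0 then 1 else 0)" for x
        by (cases "x = 0") (auto simp: rich_gf_0, simp add: rich_gf_def rich_words_empty)
      then have "(\<Sum>x\<le>k. q_binomial (k - x) (k - x) * rich_gf 0 x 0) = 1"
        by (simp add: sum.delta)
      then show ?thesis
        using rich_gf_rec[of k k k] \<open>l = 0\<close> by (simp add: p0)
    next
      case p: False
      define C where "C = q_fact p / (q_fact l * q_fact (p - l + 1))"
      define B where "B x = rich_gf (n - m) x l" for x
      \<comment> \<open>The stripped words thus fall under the induction hypothesis with
        \<open>p - l\<close>, \<open>l\<close>, \<open>x - l\<close> in the roles of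
        \<open>p\<close>, \<open>k\<close>, \<open>l\<close>.\<close>
      have nm: "n - m = 2 * (p - l) + l" "0 < n - m"
        using True p by (simp_all add: n_def m_def)
      have B0: "B x = 0" if "x < l \<or> x = 0" for x
        using that nm by (auto simp: B_def rich_gf_def rich_words_empty)
      have B: "B x = q_var ^ (l choose 2) * C *
          (q_var ^ ((x - l) * (x - 1)) * q_binomial (p - 1) (x - 1) * q_binomial (p + 1 - l) (x - l))"
        if "l \<le> x" "1 \<le> x" for x
      proof -
        have "rich_gf (2 * (p - l) + l) (l + (x - l)) l =
          q_var ^ (l choose 2) * q_var ^ ((x - l) * (l + (x - l) - 1))
            * q_binomial (p - l + l - 1) (l + (x - l) - 1)
            * q_binomial (p - l + 1) (x - l) * (q_fact (p - l + l) / (q_fact l * q_fact (p - l + 1)))"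
          using that True p less.prems by (intro less.hyps) auto
        then show ?thesis
          using that True by (simp add: B_def C_def nm Suc_diff_le)
      qed
      have Bbig: "B x = 0" if "p + 1 < x" for x
        using that True B[of x] by (simp add: q_binomial_eq_0)
      \<comment> \<open>Flipping the binomial by symmetry allows a range independent of
        \<open>m\<close>; reversing it by \<open>K = p + 1 - x\<close> gives the shape of the
        q-Pfaff--Saalschuetz sum.\<close>
      have "(\<Sum>x\<le>m. q_binomial (n - x) (m - x) * B x)
          = (\<Sum>x\<in>{1..p + 1}. q_binomial (n - x) (n - m) * B x)"
      proof (rule sum.mono_neutral_cong)
        show "q_binomial (n - i) (n - m) * B i = 0" if "i \<in> {1..p + 1} - {..m}" for i
        proof -
          have "n - i < n - m"
            using that nm(2) by auto
          then show ?thesis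
            by (simp add: q_binomial_eq_0)
        qed
        show "q_binomial (n - i) (m - i) * B i = 0" if "i \<in> {..m} - {1..p + 1}" for i
          using that B0[of i] Bbig[of i] by (cases "i = 0") auto
        show "q_binomial (n - x) (m - x) * B x = q_binomial (n - x) (n - m) * B x"
          if "x \<in> {..m} \<inter> {1..p + 1}" for x
        proof -
          have "n - x - (n - m) = m - x" "n - m \<le> n - x"
            using that mn by auto
          then show ?thesis
            using q_binomial_symmetric[of "n - m" "n - x"] by simp
        qed
      qed auto
      also have "\<dots> = (\<Sum>K\<le>p. q_binomial (n - (p + 1 - K)) (n - m) * B (p + 1 - K))"
        by (rule sum.reindex_bij_witness[of _ "\<lambda>K. p + 1 - K" "\<lambda>x. p + 1 - x"]) auto
      also have "\<dots> = (\<Sum>K\<le>p. q_var ^ (l choose 2) * C *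
          (q_var ^ ((p - K) * (p + 1 - l - K)) * q_binomial (p + 1 - l) K * q_binomial (p - 1) (p - K)
            * q_binomial (p - l + (m - 1) + K) (p - l + p)))"
      proof (rule sum.cong[OF refl])
        fix K assume "K \<in> {..p}"
        then have K: "K \<le> p"
          by simp
        show "q_binomial (n - (p + 1 - K)) (n - m) * B (p + 1 - K) = q_var ^ (l choose 2) * C *
          (q_var ^ ((p - K) * (p + 1 - l - K)) * q_binomial (p + 1 - l) K * q_binomial (p - 1) (p - K)
            * q_binomial (p - l + (m - 1) + K) (p - l + p))"
        proof (cases "K \<le> p + 1 - l")
          case Kl: True
          have e: "n - (p + 1 - K) = p - l + (m - 1) + K" "n - m = p - l + p"
              "p + 1 - K - 1 = p - K" "p + 1 - K - l = p + 1 - l - K"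
            using K True less.prems p by (auto simp: n_def m_def)
          have "B (p + 1 - K) = q_var ^ (l choose 2) * C *
              (q_var ^ ((p + 1 - l - K) * (p - K)) * q_binomial (p - 1) (p - K)
                * q_binomial (p + 1 - l) (p + 1 - l - K))"
            using K Kl True B[of "p + 1 - K"] unfolding e by simp
          then show ?thesis
            unfolding e q_binomial_symmetric[OF Kl] by (simp only: mult_ac)
        next
          case False
          then have "p + 1 - K < l"
            using K by linarith
          then show ?thesis
            using False B0[of "p + 1 - K"] by (simp add: q_binomial_eq_0)
        qed
      qed
      also have "\<dots> = q_var ^ (l choose 2) * C *
          (q_binomial (p - l + (m - 1)) (p - l) * q_binomial (m - 1 + (p + 1 - l)) p)"
        using True p
        by (subst q_pfaff_saalschutz[of "p + 1 - l" "p - 1" "p - l" p "m - 1", symmetric])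
          (simp, simp only: sum_distrib_left)
      finally have sum: "(\<Sum>x\<le>m. q_binomial (n - x) (m - x) * B x) = q_var ^ (l choose 2) * C *
          (q_binomial (p - l + (m - 1)) (p - l) * q_binomial (m - 1 + (p + 1 - l)) p)" .
      have e: "p - l + (m - 1) = p + k - 1" "m - 1 + (p + 1 - l) = p + k"
        using True less.prems by (auto simp: m_def)
      have b1: "q_binomial (p + k - 1) (p - l) = q_binomial (p + k - 1) (k + l - 1)"
        using q_binomial_symmetric[of "k + l - 1" "p + k - 1"] True less.prems by simp
      have b2: "C * q_binomial (p + k) p
          = q_binomial (p + 1) l * (q_fact (p + k) / (q_fact k * q_fact (p + 1)))"
        using True by (simp add: C_def q_binomial_def Suc_diff_le)
      \<comment> \<open>Merges the power of q from the removed row with the one from the stripped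
        words.\<close>
      have "(m choose 2) + (l choose 2) = (k choose 2) + l * (k + l - 1)"
        using choose_2_add[of k l] double_choose_2[of l] less.prems
        by (cases l) (auto simp: m_def algebra_simps)
      then have ex: "q_var ^ (m choose 2) * q_var ^ (l choose 2)
          = q_var ^ (k choose 2) * q_var ^ (l * (k + l - 1))"
        by (simp flip: power_add)
      have "m - k = l"
        by (simp add: m_def)
      have "rich_gf n m k = q_var ^ (m choose 2) * (q_var ^ (l choose 2) * C *
          (q_binomial (p + k - 1) (k + l - 1) * q_binomial (p + k) p))"
        using rich_gf_rec[OF mn] sum \<open>m - k = l\<close> unfolding B_def e b1 by (simp only:)
      also have "\<dots> = (q_var ^ (m choose 2) * q_var ^ (l choose 2)) *
          q_binomial (p + k - 1) (k + l - 1) * (C * q_binomial (p + k) p)"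
        by (simp only: mult_ac)
      finally show ?thesis
        unfolding ex b2 by (simp only: n_def m_def mult.assoc)
    qed
  qed
qed

text \<open>With \<open>m = k + j\<close> and one binomial flipped by symmetry, the product formula
  becomes a constant times the Vandermonde summand \<open>V j\<close>.\<close>

lemma sum_rich_gf:
  "(\<Sum>m\<le>2 * p + k. rich_gf (2 * p + k) m k)
     = q_var ^ (k choose 2) * q_binomial (2 * p + k) k * q_catalan p"
proof (cases "2 * p + k = 0")
  case True
  then show ?thesis
    using q_fact_1 by (simp add: rich_gf_0 q_catalan_def q_fact_def eval_nat_numeral)
next
  case False
  define C where "C = q_var ^ (k choose 2) * (q_fact (p + k) / (q_fact k * q_fact (p + 1)))"
  define V where "V j = q_var ^ (j * (p + k - 1 - (p - j))) * q_binomial (p + k - 1) (p - j)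
      * q_binomial (p + 1) j" for j
  have closed: "rich_gf (2 * p + k) (k + j) k = C * V j" if "j \<le> p" for j
  proof (cases "k + j = 0")
    \<comment> \<open>The product formula excludes this case. Here \<open>p > 0\<close>, so
      \<open>V 0\<close> contains \<open>q_binomial (p - 1) p = 0\<close>, and no nonempty
      Richardson word lacks zeros.\<close>
    case True
    then show ?thesis
      using False by (auto simp: V_def rich_gf_def rich_words_empty q_binomial_eq_0)
  next
    case kj: False
    have "p + k - 1 - (p - j) = k + j - 1"
      using that kj by simp
    moreover have "q_binomial (p + k - 1) (k + j - 1) = q_binomial (p + k - 1) (p - j)"
      using that kj q_binomial_symmetric[of "k + j - 1" "p + k - 1"] by simp
    ultimately show ?thesis
      using rich_gf_closed[of k j p] kj False by (simp add: C_def V_def mult_ac)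
  qed
  have big: "rich_gf (2 * p + k) (k + j) k = 0" if "p < j" for j
    using rich_gf_closed[of k j p] that False by (cases "k + j = 0") (auto simp: q_binomial_eq_0)
  have "(\<Sum>m\<le>2 * p + k. rich_gf (2 * p + k) m k) = (\<Sum>m\<in>{k..k + p}. rich_gf (2 * p + k) m k)"
  proof (rule sum.mono_neutral_right)
    show "\<forall>m\<in>{..2 * p + k} - {k..k + p}. rich_gf (2 * p + k) m k = 0"
    proof
      fix m assume "m \<in> {..2 * p + k} - {k..k + p}"
      then consider "m < k" | "k + p < m"
        by fastforce
      then show "rich_gf (2 * p + k) m k = 0"
      proof cases
        case 2
        then show ?thesis
          using big[of "m - k"] by simp
      qed (simp add: rich_gf_def rich_words_empty)
    qed
  qed auto
  also have "\<dots> = (\<Sum>j\<le>p. C * V j)"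
    by (rule sum.reindex_bij_witness[of _ "\<lambda>j. k + j" "\<lambda>m. m - k"]) (auto simp: closed[symmetric])
  also have "\<dots> = C * q_binomial (p + k - 1 + (p + 1)) p"
    unfolding V_def by (simp only: q_vandermonde flip: sum_distrib_left)
  also have "p + k - 1 + (p + 1) = 2 * p + k"
    using False by auto
  finally have "(\<Sum>m\<le>2 * p + k. rich_gf (2 * p + k) m k) = C * q_binomial (2 * p + k) p" .
  \<comment> \<open>Apart from the power of q, both sides cancel to [2p+k]! / ([k]! [p]!
    [p+1]!).\<close>
  also have "\<dots> = q_var ^ (k choose 2) * q_binomial (2 * p + k) k * q_catalan p"
    by (simp add: C_def q_binomial_def q_catalan_def q_fact_Suc mult_2)
  finally show ?thesis .
qed

section \<open>From words to tableaux\<close>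

text \<open>The head stands for the largest entry, so it is appended at the right end and rows come
  out increasing.\<close>

fun row :: "nat \<Rightarrow> nat list \<Rightarrow> nat list" where
  "row i [] = []"
| "row i (a # u) = row i u @ (if a = i then [Suc (length u)] else [])"

fun num_rows :: "nat list \<Rightarrow> nat" where
  "num_rows [] = 0"
| "num_rows (a # u) = max (Suc a) (num_rows u)"

definition tableau_of :: "nat list \<Rightarrow> tableau" where
  "tableau_of w = map (\<lambda>i. row i w) [0..<num_rows w]"

text \<open>Weak form of the lattice condition: enough to ensure that no row is skipped.\<close>

fun gapless :: "nat list \<Rightarrow> bool" where
  "gapless [] \<longleftrightarrow> True"
| "gapless (0 # u) \<longleftrightarrow> gapless u"
| "gapless (Suc b # u) \<longleftrightarrow> gapless u \<and> b \<in> set u"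

lemma rich_imp_gapless: "rich w \<Longrightarrow> gapless w"
  by (induction w rule: rich.induct) (auto intro: exposed_imp_in_set)

lemma gapless_Cons: "gapless (a # u) \<Longrightarrow> gapless u"
  by (cases a) auto

lemma gapless_iff_suffixes:
  "gapless w \<longleftrightarrow> (\<forall>v b u. w = v @ Suc b # u \<longrightarrow> b \<in> set u)"
proof (induction w)
  case (Cons a w)
  have "gapless (a # w) \<longleftrightarrow> gapless w \<and> (\<forall>b. a = Suc b \<longrightarrow> b \<in> set w)"
    by (cases a) auto
  then show ?case
    unfolding Cons.IH by (auto simp: Cons_eq_append_conv)
qed simp

text \<open>A new head exceeds the letters below it by at most one step, so they always fill an
  initial segment; hence \<open>tableau_of\<close> has no empty rows.\<close>

lemma gapless_set: "gapless w \<Longrightarrow> set w = {..<num_rows w}"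
proof (induction w)
  case (Cons a u)
  then have IH: "set u = {..<num_rows u}"
    using gapless_Cons by blast
  have "a \<le> num_rows u"
    using Cons.prems IH by (cases a) (simp_all add: Suc_le_eq)
  moreover have "{..<max (Suc a) n} = insert a {..<n}" if "a \<le> n" for n
    using that by (cases "a = n") (simp_all add: lessThan_Suc insert_absorb max_absorb2)
  ultimately show ?case
    by (simp add: IH)
qed simp

lemma length_row: "length (row i w) = count_list w i"
  by (induction w) auto

lemma row_eq_Nil_iff: "row i w = [] \<longleftrightarrow> i \<notin> set w"
  by (metis length_row length_0_conv count_list_0_iff)

lemma set_row: "set (row i w) = {j. 1 \<le> j \<and> j \<le> length w \<and> w ! (length w - j) = i}"
proof (induction w)
  case (Cons a u)
  show ?case
  proof (rule set_eqI)
    fix j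
    show "j \<in> set (row i (a # u)) \<longleftrightarrow>
      j \<in> {j. 1 \<le> j \<and> j \<le> length (a # u) \<and> (a # u) ! (length (a # u) - j) = i}"
    proof (cases "j \<le> length u")
      case True
      then have "length (a # u) - j = Suc (length u - j)"
        by simp
      then show ?thesis
        using True Cons.IH by (auto split: if_splits)
    next
      case False
      then show ?thesis
        using Cons.IH by (cases "j = Suc (length u)") auto
    qed
  qed
qed auto

lemma sorted_row: "sorted_wrt (<) (row i w)"
  by (induction w) (auto simp: sorted_wrt_append set_row)

lemma in_set_less_num_rows: "a \<in> set w \<Longrightarrow> a < num_rows w"
  by (induction w) auto

lemma nth_less_num_rows: "j < length w \<Longrightarrow> w ! j < num_rows w"
  by (simp add: in_set_less_num_rows)

lemma row_entries_tableau_of: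
  "row_entries (tableau_of w) i = (if i = 0 then {} else set (row (i - 1) w))"
proof -
  have "set (row i w) = {}" if "num_rows w \<le> i" for i
    using that in_set_less_num_rows[of i w] row_eq_Nil_iff[of i w] by auto
  then show ?thesis
    by (auto simp: row_entries_def tableau_of_def)
qed

lemma row_of_tableau_of:
  assumes "1 \<le> j" "j \<le> length w"
  shows "row_of (tableau_of w) j = Suc (w ! (length w - j))"
  unfolding row_of_def
  by (rule the_equality) (use assms in \<open>auto simp: row_entries_tableau_of set_row split: if_splits\<close>)

lemma set_concat_tableau_of: "set (concat (tableau_of w)) = {1..length w}"
  using nth_less_num_rows[of _ w] by (auto simp: tableau_of_def set_row)

lemma distinct_concat_tableau_of: "distinct (concat (tableau_of w))"
proof -
  have "distinct (concat (map (\<lambda>i. row i w) xs))" if "distinct xs" for xs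
    using that
    using sorted_row by (induction xs) (auto simp: set_row strict_sorted_iff)
  then show ?thesis
    by (simp add: tableau_of_def)
qed

lemma tab_size_tableau_of: "tab_size (tableau_of w) = length w"
  using distinct_card[OF distinct_concat_tableau_of[of w]]
  by (simp add: tab_size_def set_concat_tableau_of del: set_concat)

text \<open>A new box of row \<open>Suc i\<close> carries the largest entry so far, and the strict
  inequality in \<open>rich_ballot\<close> guarantees that the box above it is already
  there.\<close>

lemma column_strict:
  assumes "rich w" "c < length (row (Suc i) w)"
  shows "row i w ! c < row (Suc i) w ! c"
  using assms
proof (induction w)
  case (Cons a u)
  have u: "rich u"
    using Cons.prems(1) by (cases a) auto
  show ?case
  proof (cases "c < length (row (Suc i) u)")
    case True
    then have "c < length (row i u)"
      using rich_ballot[OF u, of i] by (simp add: length_row)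
    then show ?thesis
      using Cons.IH[OF u True] True by (simp add: nth_append)
  next
    case False
    then have a: "a = Suc i" "c = length (row (Suc i) u)"
      using Cons.prems(2) by (auto split: if_splits)
    then have "c < length (row i u)"
      using Cons.prems(1) rich_ballot[OF u, of i] by (simp add: length_row)
    moreover from this have "row i u ! c \<in> set (row i u)"
      by simp
    ultimately show ?thesis
      using a by (simp add: nth_append set_row)
  qed
qed simp

lemma tableau_of_SYT:
  assumes "rich w"
  shows "\<exists>p. is_partition (length w) p \<and> tableau_of w \<in> SYT (length w) p"
proof (intro exI conjI)
  let ?p = "shape (tableau_of w)"
  have "set w = {..<num_rows w}"
    using assms by (simp add: rich_imp_gapless gapless_set)
  then have "0 < count_list w i" if "i < num_rows w" for i
    using that by (metis count_list_0_iff gr0I lessThan_iff)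
  moreover have "count_list w j \<le> count_list w i" if "i \<le> j" for i j
    using that by (induction rule: dec_induct) (auto intro: order_trans rich_ballot[OF assms, THEN conjunct1])
  moreover have "sum_list ?p = length w"
    using tab_size_tableau_of[of w] by (simp add: shape_def tab_size_def length_concat)
  ultimately show "is_partition (length w) ?p"
    by (auto simp: is_partition_def shape_def tableau_of_def length_row sorted_wrt_iff_nth_less
        row_eq_Nil_iff)
  show "tableau_of w \<in> SYT (length w) ?p"
    using distinct_concat_tableau_of[of w] set_concat_tableau_of[of w] column_strict[OF assms]
    by (auto simp: SYT_def sorted_row tableau_of_def)
qed

lemma column_length_tableau_of: "column_length (tableau_of w) c = card {i. c < count_list w i}"
proof -
  have "i < num_rows w" if "c < count_list w i" for i
    using that length_row[of i w] row_entries_tableau_of[of w "Suc i"]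
    by (cases "i < num_rows w") (auto simp: row_entries_def tableau_of_def)
  then have "{i. i < length (tableau_of w) \<and> c < length (tableau_of w ! i)}
      = {i. c < count_list w i}"
    by (auto simp: tableau_of_def length_row)
  then show ?thesis
    by (simp add: column_length_def)
qed

lemma num_odd_columns_tableau_of: "num_odd_columns (tableau_of w) = odd_cols w"
  by (simp add: num_odd_columns_def odd_cols_def column_length_tableau_of)

text \<open>A head \<open>Suc b\<close> needs \<open>b\<close> exposed in the tail, so the next
  letter is at most \<open>b\<close> and there is a descent. Ascents therefore occur just before
  first-row entries; entry 1 adds weight 0.\<close>

lemma comaj_tableau_of:
  assumes "rich w"
  shows "comaj (tableau_of w) = zero_weight w"
proof -
  define A where "A w = {i \<in> {1..<length w}. w ! (length w - Suc i) \<le> w ! (length w - i)}"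
    for w :: "nat list"
  have "ascents (tableau_of w) = A w"
    by (auto simp: ascents_def A_def is_descent_def row_of_tableau_of tab_size_tableau_of)
  moreover have "\<Sum> (A w) = zero_weight w"
    using assms
  proof (induction w)
    case (Cons a u)
    have u: "rich u"
      using Cons.prems by (cases a) auto
    have idx: "Suc (length u) - i = Suc (length u - i)" if "i \<le> length u" for i
      using that by simp
    have "A (a # u) = A u \<union> (if u \<noteq> [] \<and> a \<le> hd u then {length u} else {})"
    proof (rule set_eqI)
      fix i
      show "i \<in> A (a # u) \<longleftrightarrow> i \<in> A u \<union> (if u \<noteq> [] \<and> a \<le> hd u then {length u} else {})"
      proof (cases "i < length u")
        case True
        then have "length u - i = Suc (length u - Suc i)"
          by simp
        then show ?thesis
          using True by (auto simp: A_def idx)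
      next
        case False
        then show ?thesis
          by (cases u) (auto simp: A_def less_Suc_eq)
      qed
    qed
    moreover have "a \<le> hd u \<longleftrightarrow> a = 0" if "u \<noteq> []"
      using Cons.prems that by (cases a; cases u) auto
    moreover have "length u \<notin> A u" "finite (A u)"
      by (auto simp: A_def)
    ultimately show ?case
      using Cons.IH[OF u] by auto
  qed (simp add: A_def)
  ultimately show ?thesis
    by (simp add: comaj_def)
qed

section \<open>Subtableaux as suffixes of the word, and the Richardson condition\<close>

lemma filter_row: "filter (\<lambda>x. x < Suc (length u)) (row i (v @ u)) = row i u"
proof (induction v)
  case Nil
  show ?case
    unfolding append_Nil by (rule filter_True) (simp add: set_row)
next
  case (Cons a v)
  have "filter (\<lambda>x. x < Suc (length u)) (if a = i then [Suc (length (v @ u))] else []) = []"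
    by simp
  then show ?case
    unfolding append_Cons row.simps filter_append Cons.IH by (simp only: append_Nil2)
qed

lemma gapless_append: "gapless (v @ u) \<Longrightarrow> gapless u"
proof (induction v)
  case (Cons a v)
  have "gapless (v @ u)"
    by (rule gapless_Cons[of a]) (use Cons.prems in \<open>simp only: append_Cons\<close>)
  then show ?case
    by (rule Cons.IH)
qed (simp only: append_Nil)

lemma num_rows_append: "num_rows (v @ u) = max (num_rows v) (num_rows u)"
  by (induction v) auto

text \<open>\<open>subtab_below\<close> drops empty rows, which preserves row numbers only when all
  empty rows are at the bottom; gaplessness ensures this.\<close>

lemma subtab_below_tableau_of:
  assumes "gapless (v @ u)"
  shows "subtab_below (tableau_of (v @ u)) (Suc (length u)) = tableau_of u"
proof -
  have "set u = {..<num_rows u}"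
    by (rule gapless_set[OF gapless_append[OF assms]])
  then have *: "row i u \<noteq> [] \<longleftrightarrow> i < num_rows u" for i
    by (simp add: row_eq_Nil_iff)
  have "num_rows u \<le> num_rows (v @ u)"
    by (simp add: num_rows_append)
  then have split: "[0..<num_rows (v @ u)] = [0..<num_rows u] @ [num_rows u..<num_rows (v @ u)]"
    using upt_add_eq_append[of 0 "num_rows u" "num_rows (v @ u) - num_rows u"] by simp
  have "subtab_below (tableau_of (v @ u)) (Suc (length u))
      = filter (\<lambda>R. R \<noteq> []) (map (\<lambda>i. row i u) [0..<num_rows (v @ u)])"
    unfolding subtab_below_def tableau_of_def map_map comp_def filter_row ..
  also have "\<dots> = map (\<lambda>i. row i u) (filter (\<lambda>i. i < num_rows u) [0..<num_rows (v @ u)])"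
    unfolding filter_map comp_def * ..
  also have "filter (\<lambda>i. i < num_rows u) [0..<num_rows (v @ u)] = [0..<num_rows u]"
    unfolding split filter_append by (simp add: filter_empty_conv)
  finally show ?thesis
    unfolding tableau_of_def .
qed

text \<open>The letter \<open>\<ge> b\<close> nearest the head marks the largest entry in rows from
  \<open>b\<close> on, and exposure says that it lies in row \<open>b\<close>. The assumption makes
  the set under \<open>Max\<close> nonempty.\<close>

lemma exposed_iff_Max:
  assumes "b \<in> set u"
  shows "exposed b u \<longleftrightarrow> (\<forall>i>b. \<forall>x\<in>set (row i u). x < Max (set (row b u)))"
  using assms
proof (induction u)
  case (Cons a u)
  have le: "x \<le> length u" if "x \<in> set (row i u)" for x i
    using that by (simp add: set_row)
  consider "a = b" | "a < b" | "b < a"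
    by linarith
  then show ?case
  proof cases
    case 1
    have "Max (insert (Suc (length u)) (set (row b u))) = Suc (length u)"
      using le by (intro Max_eqI) (auto intro: le_SucI)
    then show ?thesis
      using 1 le by (auto simp: less_Suc_eq_le)
  next
    case 2
    then show ?thesis
      using Cons by auto
  next
    case 3
    then have "b \<in> set u"
      using Cons.prems by simp
    then have "Max (set (row b u)) \<in> set (row b u)"
      using row_eq_Nil_iff[of b u] by (intro Max_in) auto
    then have "\<not> Suc (length u) < Max (set (row b u))"
      using le by fastforce
    then show ?thesis
      using 3 by auto
  qed
qed simp

lemma rich_iff_suffixes:
  "rich w \<longleftrightarrow> (\<forall>v b u. w = v @ Suc b # u \<longrightarrow> exposed b u)"
proof (induction w)
  case (Cons a w)
  have "rich (a # w) \<longleftrightarrow> rich w \<and> (\<forall>b. a = Suc b \<longrightarrow> exposed b w)"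
    by (cases a) auto
  then show ?case
    unfolding Cons.IH by (auto simp: Cons_eq_append_conv)
qed simp

text \<open>Only gaplessness is assumed, because the word of an arbitrary standard tableau is not
  yet known to be Richardson. Entry j corresponds to the suffix of length j - 1 below its
  letter.\<close>

lemma richardson_tableau_of:
  assumes "gapless w"
  shows "richardson (tableau_of w) \<longleftrightarrow> rich w"
proof -
  define P where "P j \<longleftrightarrow> (2 \<le> row_of (tableau_of w) j \<longrightarrow>
      (\<forall>i \<ge> row_of (tableau_of w) j. \<forall>x \<in> row_entries (subtab_below (tableau_of w) j) i.
        x < Max (row_entries (subtab_below (tableau_of w) j) (row_of (tableau_of w) j - 1))))"
    for j
  have P: "P (Suc (length u)) \<longleftrightarrow> (\<forall>b. a = Suc b \<longrightarrow> exposed b u)" if w: "w = v @ a # u" for v a u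
  proof -
    have row: "row_of (tableau_of w) (Suc (length u)) = Suc a"
      by (subst row_of_tableau_of) (simp_all add: w)
    have sub: "subtab_below (tableau_of w) (Suc (length u)) = tableau_of u"
      using subtab_below_tableau_of[of "v @ [a]" u] assms by (simp add: w)
    show ?thesis
    proof (cases a)
      case (Suc b)
      then have "b \<in> set u"
        using assms w unfolding gapless_iff_suffixes by blast
      have "P (Suc (length u)) \<longleftrightarrow> (\<forall>i\<ge>Suc (Suc b). \<forall>x\<in>set (row (i - 1) u).
          x < Max (set (row b u)))"
        by (auto simp: P_def row sub Suc row_entries_tableau_of)
      \<comment> \<open>Passes from row numbers starting at 1 to letters starting at 0.\<close>
      also have "\<dots> \<longleftrightarrow> (\<forall>i>b. \<forall>x\<in>set (row i u). x < Max (set (row b u)))"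
        by (metis Suc_leI Suc_le_D Suc_le_lessD diff_Suc_1 Suc_le_mono)
      finally show ?thesis
        using Suc exposed_iff_Max[OF \<open>b \<in> set u\<close>] by simp
    qed (simp add: P_def row)
  qed
  have "richardson (tableau_of w) \<longleftrightarrow> (\<forall>j\<in>{1..length w}. P j)"
    by (simp add: richardson_def P_def tab_size_tableau_of)
  also have "\<dots> \<longleftrightarrow> (\<forall>v a u. w = v @ a # u \<longrightarrow> P (Suc (length u)))"
  proof (intro iffI allI impI ballI)
    fix j assume *: "\<forall>v a u. w = v @ a # u \<longrightarrow> P (Suc (length u))" and "j \<in> {1..length w}"
    then have "w = take (length w - j) w @ w ! (length w - j) # drop (Suc (length w - j)) w"
      by (intro id_take_nth_drop) auto
    from *[rule_format, OF this] \<open>j \<in> {1..length w}\<close> show "P j"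
      by (auto simp: Suc_diff_le)
  qed auto
  also have "\<dots> \<longleftrightarrow> rich w"
    using P by (auto simp: rich_iff_suffixes)
  finally show ?thesis .
qed

section \<open>From tableaux to words\<close>

definition word_of :: "nat \<Rightarrow> tableau \<Rightarrow> nat list" where
  "word_of n T = map (\<lambda>j. row_of T j - 1) (rev [1..<Suc n])"

lemma length_word_of [simp]: "length (word_of n T) = n"
  by (simp add: word_of_def)

lemma nth_word_of:
  assumes "1 \<le> j" "j \<le> n"
  shows "word_of n T ! (n - j) = row_of T j - 1"
proof -
  have "rev [1..<Suc n] ! (n - j) = [1..<Suc n] ! (n - Suc (n - j))"
    using assms by (subst rev_nth) (simp_all del: upt_Suc)
  also have "\<dots> = j"
    using assms by (simp del: upt_Suc)
  finally show ?thesis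
    using assms by (simp add: word_of_def del: upt_Suc)
qed

lemma word_of_tableau_of: "word_of (length w) (tableau_of w) = w"
proof (rule nth_equalityI)
  fix i assume "i < length (word_of (length w) (tableau_of w))"
  then show "word_of (length w) (tableau_of w) ! i = w ! i"
    using nth_word_of[of "length w - i" "length w" "tableau_of w"]
      row_of_tableau_of[of "length w - i" w]
    by simp
qed simp

lemma distinct_concat_nth_eq:
  "distinct (concat T) \<Longrightarrow> i < length T \<Longrightarrow> k < length T \<Longrightarrow>
    x \<in> set (T ! i) \<Longrightarrow> x \<in> set (T ! k) \<Longrightarrow> i = k"
proof (induction T arbitrary: i k)
  case (Cons R T)
  have "x \<notin> set R" if "l < length T" "x \<in> set (T ! l)" for l
  proof -
    have "set R \<inter> set (T ! l) = {}"
      using Cons.prems(1) nth_mem[OF that(1)] by auto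
    then show ?thesis
      using that(2) by blast
  qed
  then show ?case
    using Cons by (cases i; cases k) auto
qed simp

lemma row_of_eq:
  assumes "distinct (concat T)" "i < length T" "j \<in> set (T ! i)"
  shows "row_of T j = Suc i"
  unfolding row_of_def
proof (rule the_equality)
  show "k = Suc i" if "j \<in> row_entries T k" for k
    using that distinct_concat_nth_eq[OF assms(1), of "k - 1" i j] assms(2,3)
    by (auto simp: row_entries_def split: if_splits)
qed (use assms in \<open>simp add: row_entries_def\<close>)

lemma num_rows_le: "(\<And>a. a \<in> set w \<Longrightarrow> a < L) \<Longrightarrow> num_rows w \<le> L"
  by (induction w) (auto simp: Suc_le_eq)

text \<open>Corresponding rows have the same entries and are both increasing, hence equal;
  gaplessness comes from the box above each box.\<close>

lemma tableau_of_word_of: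
  assumes "is_partition n p" "T \<in> SYT n p"
  shows "tableau_of (word_of n T) = T" "gapless (word_of n T)"
proof -
  define w where "w = word_of n T"
  have len: "length w = n"
    by (simp add: w_def)
  have dist: "distinct (concat T)" and entries: "set (concat T) = {1..n}"
    and rows: "\<And>R. R \<in> set T \<Longrightarrow> sorted_wrt (<) R"
    and cols: "\<And>i c. Suc i < length T \<Longrightarrow> c < length (T ! Suc i) \<Longrightarrow> T ! i ! c < T ! Suc i ! c"
    and shape: "p = map length T"
    using assms(2) by (auto simp: SYT_def shape_def)
  have letter: "j \<in> {1..n}" "w ! (n - j) = i" if "i < length T" "j \<in> set (T ! i)" for i j
  proof -
    show "j \<in> {1..n}"
      using that nth_mem[OF that(1)] unfolding entries[symmetric] by auto
    then show "w ! (n - j) = i"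
      using nth_word_of[of j n T] row_of_eq[OF dist that] by (simp add: w_def)
  qed
  have row_ex: "\<exists>i<length T. j \<in> set (T ! i)" if "j \<in> {1..n}" for j
    using that unfolding entries[symmetric] by (auto simp: in_set_conv_nth[of _ T])
  have row: "row i w = T ! i" if "i < length T" for i
  proof (rule strict_sorted_equal)
    show "set (row i w) = set (T ! i)"
    proof (intro equalityI subsetI)
      fix j assume "j \<in> set (row i w)"
      then have j: "j \<in> {1..n}" "w ! (n - j) = i"
        by (simp_all add: set_row len)
      obtain k where "k < length T" "j \<in> set (T ! k)"
        using row_ex[OF j(1)] by blast
      then show "j \<in> set (T ! i)"
        using letter(2)[of k j] j(2) by simp
    next
      show "j \<in> set (row i w)" if "j \<in> set (T ! i)" for j
        using letter[OF \<open>i < length T\<close> that] by (simp add: set_row len)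
    qed
  next
    show "sorted_wrt (<) (T ! i)"
      using rows that by simp
  qed (rule sorted_row)
  have "a < length T" if "a \<in> set w" for a
  proof -
    obtain i where i: "i < n" "a = w ! i"
      using \<open>a \<in> set w\<close> by (auto simp: in_set_conv_nth len)
    then have "n - i \<in> {1..n}"
      by simp
    then obtain k where "k < length T" "n - i \<in> set (T ! k)"
      using row_ex by blast
    then show ?thesis
      using letter(2)[of k "n - i"] i by simp
  qed
  then have "num_rows w \<le> length T"
    by (rule num_rows_le)
  \<comment> \<open>Parts of a partition are positive, so the last row of \<open>T\<close> contains
    an entry and its index occurs in \<open>w\<close>.\<close>
  moreover have "length T \<le> num_rows w"
  proof (rule ccontr)
    assume "\<not> length T \<le> num_rows w"
    then have L: "length T - 1 < length T" "num_rows w \<le> length T - 1"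
      by simp_all
    have "0 < length (T ! (length T - 1))"
      using assms(1) nth_mem[OF L(1)] by (simp add: is_partition_def shape)
    then have "row (length T - 1) w \<noteq> []"
      using row[OF L(1)] by auto
    then have "length T - 1 < num_rows w"
      using row_eq_Nil_iff in_set_less_num_rows by blast
    then show False
      using L(2) by simp
  qed
  ultimately have nr: "num_rows w = length T"
    by simp
  show "tableau_of (word_of n T) = T"
    unfolding w_def[symmetric] tableau_of_def nr by (rule nth_equalityI) (simp_all add: row)
  show "gapless (word_of n T)"
    unfolding gapless_iff_suffixes w_def[symmetric]
  proof (intro allI impI)
    fix v b u assume w: "w = v @ Suc b # u"
    have b: "Suc b < length T"
      using in_set_less_num_rows[of "Suc b" w] nr by (simp add: w)
    have "Suc (length u) \<in> set (row (Suc b) w)"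
      by (simp add: set_row w)
    then obtain c where c: "c < length (T ! Suc b)" "T ! Suc b ! c = Suc (length u)"
      using row[OF b] by (auto simp: in_set_conv_nth)
    \<comment> \<open>The box above the chosen one exists, and its smaller entry lies in the part of
      the word encoded by \<open>u\<close>, giving a letter \<open>b\<close> there.\<close>
    have "length (T ! Suc b) \<le> length (T ! b)"
      using assms(1) b by (simp add: is_partition_def shape sorted_wrt_iff_nth_less)
    then have "T ! b ! c \<in> set (row b w)"
      using c b row[of b] by simp
    moreover have "T ! b ! c < Suc (length u)"
      using cols[OF b c(1)] c(2) by simp
    ultimately have "T ! b ! c \<in> set (filter (\<lambda>x. x < Suc (length u)) (row b ((v @ [Suc b]) @ u)))"
      by (simp add: w)
    then have "row b u \<noteq> []"
      unfolding filter_row by auto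
    then show "b \<in> set u"
      by (simp add: row_eq_Nil_iff)
  qed
qed

lemma richardson_tableaux_eq_image:
  "richardson_tableaux n k = tableau_of ` (\<Union>m\<le>n. rich_words n m k)"
proof (intro equalityI subsetI)
  fix T assume "T \<in> richardson_tableaux n k"
  then obtain p where T: "is_partition n p" "T \<in> SYT n p" "richardson T" "num_odd_columns T = k"
    by (auto simp: richardson_tableaux_def)
  define w where "w = word_of n T"
  have "tableau_of w = T" "gapless w"
    using tableau_of_word_of[OF T(1,2)] by (simp_all add: w_def)
  then have "rich w" "odd_cols w = k" "length w = n"
    using T(3,4) richardson_tableau_of[of w] num_odd_columns_tableau_of[of w] by (auto simp: w_def)
  then have "w \<in> (\<Union>m\<le>n. rich_words n m k)"
    using count_le_length[of w 0] by (auto simp: rich_words_def)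
  then show "T \<in> tableau_of ` (\<Union>m\<le>n. rich_words n m k)"
    using \<open>tableau_of w = T\<close> by blast
next
  fix T assume "T \<in> tableau_of ` (\<Union>m\<le>n. rich_words n m k)"
  then obtain w where "T = tableau_of w" "rich w" "length w = n" "odd_cols w = k"
    by (auto simp: rich_words_def)
  then show "T \<in> richardson_tableaux n k"
    using tableau_of_SYT[of w] rich_imp_gapless[of w]
    by (auto simp: richardson_tableaux_def richardson_tableau_of num_odd_columns_tableau_of)
qed

lemma sum_richardson_tableaux:
  "(\<Sum>T\<in>richardson_tableaux n k. q_var ^ comaj T) = (\<Sum>m\<le>n. rich_gf n m k)"
proof -
  let ?W = "\<Union>m\<le>n. rich_words n m k"
  have "inj_on tableau_of ?W"
    by (rule inj_on_inverseI[of _ "word_of n"])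
      (use word_of_tableau_of in \<open>auto simp: rich_words_def\<close>)
  then have "(\<Sum>T\<in>richardson_tableaux n k. q_var ^ comaj T)
      = (\<Sum>w\<in>?W. q_var ^ comaj (tableau_of w))"
    by (simp add: richardson_tableaux_eq_image sum.reindex)
  also have "\<dots> = (\<Sum>w\<in>?W. q_var ^ zero_weight w)"
    by (rule sum.cong) (auto simp: rich_words_def comaj_tableau_of)
  also have "\<dots> = (\<Sum>m\<le>n. rich_gf n m k)"
    unfolding rich_gf_def
    by (rule sum.UNION_disjoint) (auto simp: finite_rich_words, auto simp: rich_words_def)
  finally show ?thesis .
qed

theorem theorem1p5:
  fixes n k :: nat
  assumes "k \<le> n" and "n mod 2 = k mod 2"
  shows "(\<Sum>T \<in> richardson_tableaux n k. q_var ^ comaj T)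
           = q_var ^ (k choose 2) * q_binomial n k * q_catalan ((n - k) div 2)"
proof -
  have "2 dvd n - k"
    using assms by (simp add: mod_eq_dvd_iff_nat)
  then have "n = 2 * ((n - k) div 2) + k"
    using assms(1) by simp
  then show ?thesis
    using sum_rich_gf[of "(n - k) div 2" k] by (simp add: sum_richardson_tableaux)
qed

end
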